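(* Assume that $r_{13}=0$. Then $I^*=(y^{c_2},z^{c_3})$.
   Context: Let $K$ be a field and let $n_1<n_2<n_3$ be positive integers with $\gcd(n_1,n_2,n_3)=1$ that minimally generate the numerical semigroup $H=\langle n_1,n_2,n_3\rangle$. Let $S=K[x,y,z]$ with the standard grading, and let $I=I_H$ be the kernel of $S\to K[t]$, $x\mapsto t^{n_1}$, $y\mapsto t^{n_2}$, $z\mapsto t^{n_3}$. Assume that $I$ is a complete intersection. For nonzero $f\in S$, $f^*$ is its homogeneous component of smallest degree, and $I^*=(f^*\mid 0\neq f\in I)$. Let $c_1,c_2,c_3$ be the smallest positive integers such that $c_1n_1\in\langle n_2,n_3\rangle$, $c_2n_2\in\langle n_1,n_3\rangle$, $c_3n_3\in\langle n_1,n_2\rangle$, and let $r_{ij}$ be non-negative integers with $c_1n_1=r_{12}n_2+r_{13}n_3$, $c_2n_2=r_{21}n_1+r_{23}n_3$, $c_3n_3=r_{31}n_1+r_{32}n_2$.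
   Formalization: Adds the assumption that r_{12}=c_2 when r_{13}=0; for an arbitrary choice of the r_{ij} the claim fails, e.g. (8,10,15) with 5·8=4·10, where I^*=(y^4,z^2). Whenever r_{13}=0 and r_{12}≠c_2, y^{c_2} is not in I^*. *)

theory Defs
  imports
    "HOL-Library.Poly_Mapping"
    "HOL-Computational_Algebra.Polynomial"
begin

definition ideal_gen :: "'r::comm_ring_1 set \<Rightarrow> 'r set" where
  "ideal_gen B = module.span (*) B"

definition regular_sequence :: "'r::comm_ring_1 list \<Rightarrow> bool" where
  "regular_sequence fs \<longleftrightarrow>
     (\<forall>i<length fs. \<forall>g. fs ! i * g \<in> ideal_gen (set (take i fs)) \<longrightarrow> g \<in> ideal_gen (set (take i fs)))
     \<and> 1 \<notin> ideal_gen (set fs)"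

definition complete_intersection :: "'r::comm_ring_1 set \<Rightarrow> bool" where
  "complete_intersection I \<longleftrightarrow> (\<exists>fs. regular_sequence fs \<and> I = ideal_gen (set fs))"

definition semigroup_gen :: "nat set \<Rightarrow> nat set" where
  "semigroup_gen A = {\<Sum>a\<in>A. u a * a | u. True}"

definition minimally_generates :: "nat set \<Rightarrow> nat set \<Rightarrow> bool" where
  "minimally_generates A H \<longleftrightarrow> semigroup_gen A = H \<and> (\<forall>B. B \<subset> A \<longrightarrow> semigroup_gen B \<noteq> H)"

definition least_multiplier :: "nat \<Rightarrow> nat set \<Rightarrow> nat" where
  "least_multiplier n A = (LEAST c. 0 < c \<and> c * n \<in> semigroup_gen A)"

datatype var = X | Y | Z

text \<open>\<open>K[x,y,z]\<close> as the monoid algebra of \<open>K\<close> over the exponent vectors.\<close>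

type_synonym 'k poly3 = "(var \<Rightarrow>\<^sub>0 nat) \<Rightarrow>\<^sub>0 'k"

definition indet :: "var \<Rightarrow> 'k::field poly3" where
  "indet v = Poly_Mapping.single (Poly_Mapping.single v 1) 1"

definition mon_degree :: "(var \<Rightarrow>\<^sub>0 nat) \<Rightarrow> nat" where
  "mon_degree m = Poly_Mapping.lookup m X + Poly_Mapping.lookup m Y + Poly_Mapping.lookup m Z"

definition hom_component :: "nat \<Rightarrow> 'k::field poly3 \<Rightarrow> 'k poly3" where
  "hom_component d f =
     (\<Sum>m\<in>{m \<in> Poly_Mapping.keys f. mon_degree m = d}. Poly_Mapping.single m (Poly_Mapping.lookup f m))"

text \<open>The form \<open>f\<^sup>*\<close>; meaningful only for \<open>f \<noteq> 0\<close>.\<close>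

definition initial_form :: "'k::field poly3 \<Rightarrow> 'k poly3" where
  "initial_form f = hom_component (LEAST d. hom_component d f \<noteq> 0) f"

definition initial_ideal :: "'k::field poly3 set \<Rightarrow> 'k poly3 set" where
  "initial_ideal I = ideal_gen {initial_form f | f. f \<in> I \<and> f \<noteq> 0}"

definition param_map :: "nat \<Rightarrow> nat \<Rightarrow> nat \<Rightarrow> 'k::field poly3 \<Rightarrow> 'k poly" where
  "param_map n1 n2 n3 f =
     (\<Sum>m\<in>Poly_Mapping.keys f. smult (Poly_Mapping.lookup f m)
        (monom 1 n1 ^ Poly_Mapping.lookup m X
         * monom 1 n2 ^ Poly_Mapping.lookup m Y
         * monom 1 n3 ^ Poly_Mapping.lookup m Z))"

definition defining_ideal :: "nat \<Rightarrow> nat \<Rightarrow> nat \<Rightarrow> 'k::field poly3 set" where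
  "defining_ideal n1 n2 n3 = {f. param_map n1 n2 n3 f = 0}"

end

theory Submission
  imports Defs "HOL-Number_Theory.Cong"
begin

text \<open>
  Put \<open>d = gcd n1 n2\<close>. The relation \<open>c1 n1 = c2 n2\<close> and the minimality of \<open>c2\<close> force
  \<open>c1 = n2/d\<close>, \<open>c2 = n1/d\<close> and \<open>c3 = d\<close> (\<open>multipliers_of_balanced_relation\<close>).

  Weight a monomial \<open>x^i y^j z^k\<close> by \<open>i n1 + j n2 + k n3\<close>, the exponent of its image in \<open>K[t]\<close>.
  A polynomial lies in \<open>I\<close> exactly if for every weight its coefficients of that weight add up
  to \<open>0\<close>. Call a monomial reduced if \<open>j < c2\<close> and \<open>k < c3\<close>, that is, if it lies outside
  \<open>(y^c2, z^c3)\<close>. There are two facts about reduced monomials.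
    \<^item> Two reduced monomials of equal weight are equal (\<open>reduced_eq_of_weight_eq\<close>): modulo \<open>d\<close>
      the weight determines \<open>k\<close>, and then modulo \<open>n1\<close> it determines \<open>j\<close>.
    \<^item> A reduced monomial has strictly larger degree than every other monomial of its weight
      (\<open>degree_less_reduced\<close>): the replacements of \<open>y^c2\<close> by \<open>x^c1\<close> and of \<open>z^c3\<close> by
      \<open>x^r31 y^r32\<close> preserve the weight and raise the degree, because \<open>n1 < n2 < n3\<close>. They lead
      from any monomial to a reduced one.

  Now let \<open>f \<in> I\<close> be nonzero. If a reduced monomial occurred in the lowest form of \<open>f\<close>, then
  every other monomial of \<open>f\<close> of the same weight would have at least the same degree, and by the
  second fact there is none; but then the coefficients of this weight do not add up to \<open>0\<close>.
  Hence the lowest form lies in \<open>(y^c2, z^c3)\<close>. Conversely \<open>y^c2\<close> and \<open>z^c3\<close> are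
  the lowest forms of the binomials \<open>y^c2 - x^c1\<close> and \<open>z^c3 - x^r31 y^r32\<close> of \<open>I\<close>.
\<close>

section \<open>Least multipliers\<close>

lemma semigroup_gen_pair:
  assumes "a \<noteq> b"
  shows "semigroup_gen {a, b} = {u * a + v * b | u v. True}"
proof (intro set_eqI iffI)
  fix x assume "x \<in> semigroup_gen {a, b}"
  then obtain u where "x = (\<Sum>i\<in>{a, b}. u i * i)" by (auto simp: semigroup_gen_def)
  then have "x = u a * a + u b * b" using assms by simp
  then show "x \<in> {u * a + v * b | u v. True}" by blast
next
  fix x assume "x \<in> {u * a + v * b | u v. True}"
  then obtain u v where "x = u * a + v * b" by blast
  then have "x = (\<Sum>i\<in>{a, b}. (if i = a then u else v) * i)" using assms by simp
  then show "x \<in> semigroup_gen {a, b}" unfolding semigroup_gen_def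
    by (intro CollectI exI[of _ "\<lambda>i. if i = a then u else v"]) simp
qed

lemma least_multiplier_pos:
  assumes "0 < a" and "a \<noteq> b"
  shows "0 < least_multiplier n {a, b}"
proof -
  have "a * n = n * a + 0 * b" by simp
  then have "a * n \<in> semigroup_gen {a, b}"
    unfolding semigroup_gen_pair[OF assms(2)] by blast
  with assms(1) have "0 < a \<and> a * n \<in> semigroup_gen {a, b}" by simp
  from LeastI[of "\<lambda>c. 0 < c \<and> c * n \<in> semigroup_gen {a, b}", OF this]
  show ?thesis by (simp add: least_multiplier_def)
qed

lemma least_multiplier_le:
  assumes "a \<noteq> b" and "0 < c" and "c * n = u * a + v * b"
  shows "least_multiplier n {a, b} \<le> c"
  unfolding least_multiplier_def
  using assms by (intro Least_le) (auto simp: semigroup_gen_pair)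

text \<open>
  The equality \<open>c3 = gcd n1 n2\<close> is the point of this lemma. With \<open>n1 = d a\<close> and \<open>n2 = d b\<close> it
  says that \<open>n3\<close> is a combination of \<open>a\<close> and \<open>b\<close>. Choose \<open>v < a\<close> with \<open>v b\<close> congruent to
  \<open>n3\<close> modulo \<open>a\<close>. If \<open>v b > n3\<close>, then \<open>v n2\<close> is a combination of \<open>n1\<close> and \<open>n3\<close>, against the
  minimality of \<open>c2 = a\<close>.
\<close>

lemma multipliers_of_balanced_relation:
  fixes n1 n2 n3 c1 c2 :: nat
  assumes n: "0 < n1" "n1 < n2" "n2 < n3"
    and gcd: "Gcd {n1, n2, n3} = 1"
    and c2: "c2 = least_multiplier n2 {n1, n3}"
    and c3: "c3 = least_multiplier n3 {n1, n2}"
    and bal: "c1 * n1 = c2 * n2"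
    and rel: "c3 * n3 = r31 * n1 + r32 * n2"
  shows "n1 = c3 * c2" and "n2 = c3 * c1" and "coprime c1 c2" and "coprime c3 n3"
proof -
  define d where "d = gcd n1 n2"
  have d0: "0 < d" using n by (simp add: d_def)
  obtain a b where ab: "n1 = d * a" "n2 = d * b" "coprime a b"
    using gcd_coprime_exists[of n1 n2] n d_def by (metis d0 mult.commute neq0_conv)
  have cop: "coprime d n3" using gcd by (simp add: d_def coprime_iff_gcd_eq_1 gcd.assoc)
  have a0: "0 < a" and b0: "0 < b" using ab n by auto
  have c2pos: "0 < c2" using least_multiplier_pos[of n1 n3 n2] c2 n by simp
  have bal': "c1 * a = c2 * b" using bal ab d0 by simp
  then have "a dvd c2" using ab(3)
    by (metis coprime_dvd_mult_left_iff dvd_triv_right)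
  then have "a \<le> c2" using c2pos by (simp add: dvd_imp_le)
  moreover have "c2 \<le> a"
    unfolding c2
  proof (rule least_multiplier_le[OF _ a0])
    show "a * n2 = b * n1 + 0 * n3" using ab by simp
  qed (use n in simp)
  ultimately have c2a: "c2 = a" by simp
  then have c1b: "c1 = b" using bal' a0 by simp
  have "\<exists>u v. n3 = u * a + v * b"
  proof -
    obtain y where y: "[b * y = 1] (mod a)"
      using cong_solve_coprime_nat[of b a] ab(3) by (auto simp: coprime_commute)
    define v where "v = (y * n3) mod a"
    have "v < a" using a0 by (simp add: v_def)
    have "[b * v = b * (y * n3)] (mod a)" by (simp add: v_def cong_def mod_mult_right_eq)
    also have "[b * (y * n3) = 1 * n3] (mod a)"
      using cong_mult[OF y cong_refl[of n3]] by (simp add: mult.assoc)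
    finally have vb: "[v * b = n3] (mod a)" by (simp add: mult.commute)
    show ?thesis
    proof (cases "v * b \<le> n3")
      case True
      then obtain u where "n3 = u * a + v * b"
        using vb by (metis cong_le_nat cong_sym)
      then show ?thesis by blast
    next
      case False
      then obtain u where u: "v * b = u * a + n3"
        using vb by (metis cong_le_nat nat_le_linear)
      have "0 < v" using False by (cases v) auto
      have "v * n2 = d * (v * b)" by (simp add: ab)
      also have "\<dots> = u * n1 + d * n3" unfolding u by (simp add: ab algebra_simps)
      finally have "c2 \<le> v" unfolding c2
        using \<open>0 < v\<close> n by (intro least_multiplier_le) auto
      then show ?thesis using \<open>v < a\<close> c2a by simp
    qed
  qed
  then obtain u v where uv: "n3 = u * a + v * b" by blast
  have "c3 \<le> d" unfolding c3
  proof (rule least_multiplier_le[OF _ d0])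
    show "d * n3 = u * n1 + v * n2" by (simp add: uv ab algebra_simps)
  qed (use n in simp)
  moreover have "d \<le> c3"
  proof -
    have "d dvd c3 * n3" unfolding rel by (simp add: ab)
    then have "d dvd c3" using cop by (simp add: coprime_dvd_mult_left_iff)
    moreover have "0 < c3" using least_multiplier_pos[of n1 n2 n3] c3 n by simp
    ultimately show ?thesis by (simp add: dvd_imp_le)
  qed
  ultimately have c3d: "c3 = d" by simp
  show "n1 = c3 * c2" "n2 = c3 * c1" "coprime c1 c2" "coprime c3 n3"
    using ab cop c1b c2a c3d by (simp_all add: coprime_commute)
qed

section \<open>Reduced monomials\<close>

definition monom3 :: "nat \<Rightarrow> nat \<Rightarrow> nat \<Rightarrow> (var \<Rightarrow>\<^sub>0 nat)" where
  "monom3 i j k = Poly_Mapping.single X i + Poly_Mapping.single Y j + Poly_Mapping.single Z k"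

lemma lookup_monom3 [simp]:
  "Poly_Mapping.lookup (monom3 i j k) X = i"
  "Poly_Mapping.lookup (monom3 i j k) Y = j"
  "Poly_Mapping.lookup (monom3 i j k) Z = k"
  by (simp_all add: monom3_def lookup_add lookup_single)

lemma exponent_eqI:
  fixes m m' :: "var \<Rightarrow>\<^sub>0 nat"
  assumes "Poly_Mapping.lookup m X = Poly_Mapping.lookup m' X"
    and "Poly_Mapping.lookup m Y = Poly_Mapping.lookup m' Y"
    and "Poly_Mapping.lookup m Z = Poly_Mapping.lookup m' Z"
  shows "m = m'"
proof (rule poly_mapping_eqI)
  fix v show "Poly_Mapping.lookup m v = Poly_Mapping.lookup m' v"
    using assms by (cases v) auto
qed

lemma mon_degree_monom3 [simp]: "mon_degree (monom3 i j k) = i + j + k"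
  by (simp add: mon_degree_def)

definition weight :: "nat \<Rightarrow> nat \<Rightarrow> nat \<Rightarrow> (var \<Rightarrow>\<^sub>0 nat) \<Rightarrow> nat" where
  "weight n1 n2 n3 m = n1 * Poly_Mapping.lookup m X + n2 * Poly_Mapping.lookup m Y
     + n3 * Poly_Mapping.lookup m Z"

lemma weight_monom3 [simp]: "weight n1 n2 n3 (monom3 i j k) = n1 * i + n2 * j + n3 * k"
  by (simp add: weight_def)

lemma mon_degree_le_weight:
  assumes "0 < n1" "0 < n2" "0 < n3"
  shows "mon_degree m \<le> weight n1 n2 n3 m"
  unfolding mon_degree_def weight_def using assms by (intro add_mono) simp_all

definition reduced :: "nat \<Rightarrow> nat \<Rightarrow> (var \<Rightarrow>\<^sub>0 nat) \<Rightarrow> bool" where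
  "reduced c2 c3 m \<longleftrightarrow> Poly_Mapping.lookup m Y < c2 \<and> Poly_Mapping.lookup m Z < c3"

lemma eq_of_coprime_mult_add_eq:
  fixes p q i i' j j' :: nat
  assumes "coprime p q" and "j < q" and "j' < q" and "q * i + p * j = q * i' + p * j'"
  shows "j = j'"
proof -
  have "[p * j = p * j'] (mod q)"
    using arg_cong[OF assms(4), of "\<lambda>x. x mod q"] by (simp add: cong_def)
  then have "[j = j'] (mod q)" using assms(1) by (simp add: cong_mult_lcancel_nat coprime_commute)
  then show ?thesis using assms(2,3) by (simp add: cong_def)
qed

lemma reduced_eq_of_weight_eq:
  assumes n: "n1 = c3 * c2" "n2 = c3 * c1" "coprime c1 c2" "coprime c3 n3" "0 < n1"
    and red: "reduced c2 c3 m" "reduced c2 c3 m'"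
    and w: "weight n1 n2 n3 m = weight n1 n2 n3 m'"
  shows "m = m'"
proof -
  let ?x = "Poly_Mapping.lookup m X" and ?y = "Poly_Mapping.lookup m Y"
    and ?z = "Poly_Mapping.lookup m Z"
  let ?x' = "Poly_Mapping.lookup m' X" and ?y' = "Poly_Mapping.lookup m' Y"
    and ?z' = "Poly_Mapping.lookup m' Z"
  have "c3 * (c2 * ?x + c1 * ?y) + n3 * ?z = c3 * (c2 * ?x' + c1 * ?y') + n3 * ?z'"
    using w by (simp add: weight_def n(1,2) algebra_simps)
  moreover from this have z: "?z = ?z'"
    using eq_of_coprime_mult_add_eq[of n3 c3 ?z ?z'] red n(4)
    by (simp add: reduced_def coprime_commute)
  ultimately have xy: "c2 * ?x + c1 * ?y = c2 * ?x' + c1 * ?y'" using n(1,5) by simp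
  then have y: "?y = ?y'"
    using eq_of_coprime_mult_add_eq[of c1 c2 ?y ?y'] red n(3) by (simp add: reduced_def)
  with xy have "?x = ?x'" using n(1,5) by simp
  with y z show ?thesis by (intro exponent_eqI)
qed

lemma raise_degree_of_not_reduced:
  assumes rel: "c1 * n1 = c2 * n2" "c3 * n3 = r1 * n1 + r2 * n2"
    and deg: "c2 < c1" "c3 < r1 + r2"
    and m: "\<not> reduced c2 c3 m"
  obtains m' where "weight n1 n2 n3 m' = weight n1 n2 n3 m" and "mon_degree m < mon_degree m'"
proof -
  let ?x = "Poly_Mapping.lookup m X" and ?y = "Poly_Mapping.lookup m Y"
    and ?z = "Poly_Mapping.lookup m Z"
  consider "c2 \<le> ?y" | "c3 \<le> ?z" using m by (auto simp: reduced_def not_less)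
  then show thesis
  proof cases
    case 1
    then obtain j where j: "?y = c2 + j" using le_Suc_ex by blast
    have "n1 * c1 = n2 * c2" using rel(1) by (simp add: mult.commute)
    then show thesis using that[of "monom3 (?x + c1) j ?z"] deg(1) j
      by (simp add: weight_def mon_degree_def[of m] algebra_simps)
  next
    case 2
    then obtain k where k: "?z = c3 + k" using le_Suc_ex by blast
    have "n3 * c3 = n1 * r1 + n2 * r2" using rel(2) by (simp add: mult.commute)
    then show thesis using that[of "monom3 (?x + r1) (?y + r2) k"] deg(2) k
      by (simp add: weight_def mon_degree_def[of m] algebra_simps)
  qed
qed

text \<open>
  All monomials of one weight have degree at most that weight, so raising the degree repeatedly
  ends in a reduced monomial, which is the only one of its weight.
\<close>

lemma degree_less_reduced:
  assumes n: "n1 = c3 * c2" "n2 = c3 * c1" "coprime c1 c2" "coprime c3 n3"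
    and pos: "0 < n1" "0 < n2" "0 < n3"
    and rel: "c3 * n3 = r1 * n1 + r2 * n2"
    and deg: "c2 < c1" "c3 < r1 + r2"
    and m: "reduced c2 c3 m"
    and w: "weight n1 n2 n3 m' = weight n1 n2 n3 m"
    and ne: "m' \<noteq> m"
  shows "mon_degree m' < mon_degree m"
  using w ne
proof (induction "weight n1 n2 n3 m - mon_degree m'" arbitrary: m' rule: less_induct)
  case less
  have "\<not> reduced c2 c3 m'"
    using reduced_eq_of_weight_eq[OF n pos(1) _ m less.prems(1)] less.prems(2) by blast
  moreover have "c1 * n1 = c2 * n2" by (simp add: n)
  ultimately obtain m'' where m'': "weight n1 n2 n3 m'' = weight n1 n2 n3 m'"
      "mon_degree m' < mon_degree m''"
    using raise_degree_of_not_reduced[of c1 n1 c2 n2 c3 n3 r1 r2 m'] rel deg by blast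
  have "mon_degree m'' \<le> weight n1 n2 n3 m"
    using mon_degree_le_weight[OF pos, of m''] m''(1) less.prems(1) by simp
  then show ?case
    using less.hyps[of m''] m'' less.prems by (cases "m'' = m") force+
qed

section \<open>The defining ideal and lowest forms\<close>

lemma coeff_param_map:
  "coeff (param_map n1 n2 n3 f) w =
     (\<Sum>m\<in>{m \<in> Poly_Mapping.keys f. weight n1 n2 n3 m = w}. Poly_Mapping.lookup f m)"
proof -
  have "coeff (param_map n1 n2 n3 f) w =
      (\<Sum>m\<in>Poly_Mapping.keys f. if weight n1 n2 n3 m = w then Poly_Mapping.lookup f m else 0)"
    unfolding param_map_def coeff_sum
    by (intro sum.cong refl)
      (simp add: monom_power mult_monom weight_def mult.commute)
  then show ?thesis by (simp add: sum.If_cases Int_def)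
qed

lemma binomial_in_defining_ideal:
  assumes "m \<noteq> m'" and "weight n1 n2 n3 m = weight n1 n2 n3 m'"
  shows "Poly_Mapping.single m 1 - Poly_Mapping.single m' 1
    \<in> (defining_ideal n1 n2 n3 :: 'k::field poly3 set)"
proof -
  let ?f = "Poly_Mapping.single m 1 - Poly_Mapping.single m' 1 :: 'k poly3"
  have keys: "Poly_Mapping.keys ?f = {m, m'}"
    using assms(1) by (auto simp: in_keys_iff lookup_minus lookup_single when_def split: if_splits)
  have "param_map n1 n2 n3 ?f = 0"
  proof (rule poly_eqI)
    fix w
    have "{x \<in> {m, m'}. weight n1 n2 n3 x = w} = (if weight n1 n2 n3 m = w then {m, m'} else {})"
      using assms(2) by auto
    then show "coeff (param_map n1 n2 n3 ?f) w = coeff 0 w"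
      unfolding coeff_param_map keys using assms(1)
      by (simp add: lookup_minus lookup_single)
  qed
  then show ?thesis by (simp add: defining_ideal_def)
qed

lemma lookup_hom_component:
  "Poly_Mapping.lookup (hom_component d f) m = (if mon_degree m = d then Poly_Mapping.lookup f m else 0)"
proof -
  have "Poly_Mapping.lookup (hom_component d f) m =
      (\<Sum>x\<in>{x \<in> Poly_Mapping.keys f. mon_degree x = d}. if x = m then Poly_Mapping.lookup f x else 0)"
    by (simp add: hom_component_def lookup_sum lookup_single when_def)
  also have "\<dots> = (if mon_degree m = d then Poly_Mapping.lookup f m else 0)"
    by (auto simp: in_keys_iff)
  finally show ?thesis .
qed

lemma hom_component_nonzero_iff:
  "hom_component d f \<noteq> 0 \<longleftrightarrow> (\<exists>m\<in>Poly_Mapping.keys f. mon_degree m = d)"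
  by (auto simp: poly_mapping_eq_iff fun_eq_iff lookup_hom_component in_keys_iff)

lemma keys_initial_form:
  assumes "m \<in> Poly_Mapping.keys (initial_form f)"
  shows "m \<in> Poly_Mapping.keys f" and "m' \<in> Poly_Mapping.keys f \<Longrightarrow> mon_degree m \<le> mon_degree m'"
proof -
  let ?d = "LEAST d. hom_component d f \<noteq> 0"
  have m: "mon_degree m = ?d" "Poly_Mapping.lookup f m \<noteq> 0"
    using assms by (auto simp: in_keys_iff initial_form_def lookup_hom_component split: if_splits)
  then show "m \<in> Poly_Mapping.keys f" by (simp add: in_keys_iff)
  assume "m' \<in> Poly_Mapping.keys f"
  then have "hom_component (mon_degree m') f \<noteq> 0" by (auto simp: hom_component_nonzero_iff)
  then show "mon_degree m \<le> mon_degree m'" unfolding m(1) by (rule Least_le)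
qed

lemma initial_form_binomial:
  assumes "mon_degree m < mon_degree m'"
  shows "initial_form (Poly_Mapping.single m 1 - Poly_Mapping.single m' 1 :: 'k::field poly3)
    = Poly_Mapping.single m 1"
proof -
  let ?f = "Poly_Mapping.single m 1 - Poly_Mapping.single m' 1 :: 'k poly3"
  have "m \<noteq> m'" using assms by auto
  then have keys: "Poly_Mapping.keys ?f = {m, m'}"
    by (auto simp: in_keys_iff lookup_minus lookup_single when_def split: if_splits)
  have "(LEAST d. hom_component d ?f \<noteq> 0) = mon_degree m"
    by (rule Least_equality) (use assms in \<open>auto simp: hom_component_nonzero_iff keys\<close>)
  then show ?thesis using assms unfolding initial_form_def
    by (intro poly_mapping_eqI)
      (auto simp: lookup_hom_component lookup_minus lookup_single when_def)
qed

text \<open>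
  A reduced monomial of the lowest form would be the only monomial of its weight in \<open>f\<close>, since the
  others of that weight have too small a degree to occur; its coefficient could not cancel.
\<close>

lemma initial_form_not_reduced:
  fixes f :: "'k::field poly3"
  assumes n: "n1 = c3 * c2" "n2 = c3 * c1" "coprime c1 c2" "coprime c3 n3"
    and pos: "0 < n1" "0 < n2" "0 < n3"
    and rel: "c3 * n3 = r1 * n1 + r2 * n2"
    and deg: "c2 < c1" "c3 < r1 + r2"
    and f: "f \<in> defining_ideal n1 n2 n3"
    and m: "m \<in> Poly_Mapping.keys (initial_form f)"
  shows "\<not> reduced c2 c3 m"
proof
  assume red: "reduced c2 c3 m"
  have "{m' \<in> Poly_Mapping.keys f. weight n1 n2 n3 m' = weight n1 n2 n3 m} = {m}"
    using keys_initial_form[OF m] degree_less_reduced[OF n pos rel deg red]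
    by (auto simp: not_less[symmetric])
  then have "coeff (param_map n1 n2 n3 f) (weight n1 n2 n3 m) = Poly_Mapping.lookup f m"
    by (simp add: coeff_param_map)
  then show False using f keys_initial_form(1)[OF m]
    by (simp add: defining_ideal_def in_keys_iff)
qed

section \<open>Ideals generated by monomials\<close>

lemma module_mult: "module ((*) :: 'r::comm_ring_1 \<Rightarrow> 'r \<Rightarrow> 'r)"
  by unfold_locales (simp_all add: algebra_simps)

lemma ideal_gen_base: "a \<in> B \<Longrightarrow> a \<in> ideal_gen B"
  unfolding ideal_gen_def by (rule module.span_base[OF module_mult])

lemma ideal_gen_mult: "a \<in> ideal_gen B \<Longrightarrow> c * a \<in> ideal_gen B"
  unfolding ideal_gen_def by (rule module.span_scale[OF module_mult])

lemma ideal_gen_sum: "(\<And>x. x \<in> A \<Longrightarrow> f x \<in> ideal_gen B) \<Longrightarrow> sum f A \<in> ideal_gen B"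
  unfolding ideal_gen_def by (rule module.span_sum[OF module_mult])

lemma ideal_gen_subset_iff: "ideal_gen A \<subseteq> ideal_gen B \<longleftrightarrow> A \<subseteq> ideal_gen B"
proof
  assume "ideal_gen A \<subseteq> ideal_gen B"
  then show "A \<subseteq> ideal_gen B" using ideal_gen_base by blast
next
  assume "A \<subseteq> ideal_gen B"
  then show "ideal_gen A \<subseteq> ideal_gen B" unfolding ideal_gen_def
    by (intro module.span_minimal[OF module_mult] module.subspace_span[OF module_mult])
qed

lemma indet_power: "indet v ^ n = Poly_Mapping.single (Poly_Mapping.single v n) 1"
  by (induction n) (simp_all add: indet_def mult_single single_add[symmetric])

lemma single_in_ideal_gen_of_power:
  assumes "indet v ^ n \<in> B" and "n \<le> Poly_Mapping.lookup m v"
  shows "Poly_Mapping.single m c \<in> ideal_gen B"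
proof -
  have "m = (m - Poly_Mapping.single v n) + Poly_Mapping.single v n"
    using assms(2)
    by (intro poly_mapping_eqI) (auto simp: lookup_add lookup_minus lookup_single when_def)
  then have "Poly_Mapping.single m c =
      Poly_Mapping.single (m - Poly_Mapping.single v n) c * indet v ^ n"
    by (simp add: indet_power mult_single)
  then show ?thesis using ideal_gen_mult[OF ideal_gen_base[OF assms(1)]] by simp
qed

lemma sum_of_monomials:
  fixes f :: "'a \<Rightarrow>\<^sub>0 'b::comm_monoid_add"
  shows "f = (\<Sum>m\<in>Poly_Mapping.keys f. Poly_Mapping.single m (Poly_Mapping.lookup f m))"
proof (rule poly_mapping_eqI)
  fix x
  show "Poly_Mapping.lookup f x = Poly_Mapping.lookup
      (\<Sum>m\<in>Poly_Mapping.keys f. Poly_Mapping.single m (Poly_Mapping.lookup f m)) x"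
    by (simp add: lookup_sum lookup_single when_def in_keys_iff)
qed

lemma in_ideal_gen_of_not_reduced:
  fixes f :: "'k::field poly3"
  assumes "\<And>m. m \<in> Poly_Mapping.keys f \<Longrightarrow> \<not> reduced c2 c3 m"
  shows "f \<in> ideal_gen {indet Y ^ c2, indet Z ^ c3}"
proof -
  have "Poly_Mapping.single m (Poly_Mapping.lookup f m) \<in> ideal_gen {indet Y ^ c2, indet Z ^ c3}"
    if "m \<in> Poly_Mapping.keys f" for m
    using assms[OF that] single_in_ideal_gen_of_power[of Y c2 "{indet Y ^ c2, indet Z ^ c3}" m]
      single_in_ideal_gen_of_power[of Z c3 "{indet Y ^ c2, indet Z ^ c3}" m]
    by (auto simp: reduced_def not_less)
  then show ?thesis by (subst sum_of_monomials) (rule ideal_gen_sum)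
qed

section \<open>The initial ideal\<close>

theorem lemma3p1:
  fixes n1 n2 n3 c1 c2 c3 r12 r13 r21 r23 r31 r32 :: nat
    and H :: "nat set"
    and I :: "'k::field poly3 set"
  assumes "0 < n1" and "n1 < n2" and "n2 < n3"
    and "Gcd {n1, n2, n3} = 1"
    and "minimally_generates {n1, n2, n3} H"
    and "I = defining_ideal n1 n2 n3"
    and "complete_intersection I"
    and "c1 = least_multiplier n1 {n2, n3}"
    and "c2 = least_multiplier n2 {n1, n3}"
    and "c3 = least_multiplier n3 {n1, n2}"
    and "c1 * n1 = r12 * n2 + r13 * n3"
    and "c2 * n2 = r21 * n1 + r23 * n3"
    and "c3 * n3 = r31 * n1 + r32 * n2"
    (* The r_ij are not unique. A relation c1 n1 = r12 n2 is only admitted as the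
       choice of (r12, r13) when it is the minimal one, c1 n1 = c2 n2. *)
    and choice_of_r: "r13 = 0 \<longrightarrow> r12 = c2"
    and "r13 = 0"
  shows "initial_ideal I = ideal_gen {indet Y ^ c2, indet Z ^ c3}"
proof -
  note rel = \<open>c3 * n3 = r31 * n1 + r32 * n2\<close> and I = \<open>I = defining_ideal n1 n2 n3\<close>
  have bal: "c1 * n1 = c2 * n2"
    using choice_of_r \<open>r13 = 0\<close> \<open>c1 * n1 = r12 * n2 + r13 * n3\<close> by simp
  note mult = multipliers_of_balanced_relation[OF assms(1-4,9,10) bal rel]
  have pos: "0 < n1" "0 < n2" "0 < n3" using assms(1-3) by auto
  have c3: "0 < c3" using mult(1) pos by (cases c3) auto
  have deg1: "c2 < c1" using mult(1,2) \<open>n1 < n2\<close> by simp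
  have deg2: "c3 < r31 + r32"
  proof (rule ccontr)
    assume "\<not> c3 < r31 + r32"
    then have "(r31 + r32) * n2 \<le> c3 * n2" by simp
    also have "\<dots> < c3 * n3" using c3 \<open>n2 < n3\<close> by simp
    also have "\<dots> \<le> (r31 + r32) * n2" using \<open>n1 < n2\<close> by (simp add: rel add_mult_distrib)
    finally show False by simp
  qed
  have lowest: "Poly_Mapping.single m 1 \<in> ideal_gen {initial_form f | f. f \<in> I \<and> f \<noteq> 0}"
    if "weight n1 n2 n3 m = weight n1 n2 n3 m'" "mon_degree m < mon_degree m'" for m m'
  proof -
    let ?f = "Poly_Mapping.single m 1 - Poly_Mapping.single m' 1 :: 'k poly3"
    have ne: "m \<noteq> m'" using that(2) by auto
    then have "Poly_Mapping.lookup ?f m \<noteq> 0"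
      by (simp add: lookup_minus lookup_single)
    then have "?f \<noteq> 0" by (metis lookup_zero)
    moreover have "?f \<in> I" unfolding I using ne that(1) by (rule binomial_in_defining_ideal)
    ultimately show ?thesis
      by (intro ideal_gen_base) (use initial_form_binomial[OF that(2), symmetric] in blast)
  qed
  have "Poly_Mapping.single (monom3 0 c2 0) 1 \<in> ideal_gen {initial_form f | f. f \<in> I \<and> f \<noteq> 0}"
    using lowest[of "monom3 0 c2 0" "monom3 c1 0 0"] bal deg1 by (simp add: mult.commute)
  moreover have "Poly_Mapping.single (monom3 0 0 c3) 1 \<in> ideal_gen {initial_form f | f. f \<in> I \<and> f \<noteq> 0}"
    using lowest[of "monom3 0 0 c3" "monom3 r31 r32 0"] rel deg2 by (simp add: mult.commute)
  ultimately have "indet Y ^ c2 \<in> ideal_gen {initial_form f | f. f \<in> I \<and> f \<noteq> 0}"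
    and "indet Z ^ c3 \<in> ideal_gen {initial_form f | f. f \<in> I \<and> f \<noteq> 0}"
    by (simp_all add: indet_power monom3_def)
  then have "ideal_gen {indet Y ^ c2, indet Z ^ c3} \<subseteq> initial_ideal I"
    unfolding initial_ideal_def ideal_gen_subset_iff by blast
  moreover have "initial_ideal I \<subseteq> ideal_gen {indet Y ^ c2, indet Z ^ c3}"
    unfolding initial_ideal_def ideal_gen_subset_iff
    using initial_form_not_reduced[OF mult pos rel deg1 deg2] I
    by (auto intro!: in_ideal_gen_of_not_reduced)
  ultimately show ?thesis by blast
qed

end
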